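(* Let $\nu:\mathbb{C}[X]\to\mathbb{C}$ be the linear functional with $\nu(1)=1$ whose free cumulants are $\kappa_{2n-1}(\nu)=0$ and $\kappa_{2n}(\nu)=m_n^{(1)}$ for all $n\in\mathbb{N}=\{1,2,\dots\}$, where $m_n^{(1)}:=|\{(\pi,\rho)\in NC(n)^2\mid M_{\pi,\rho}\text{ is a meander}\}|$. Then for every $n\in\mathbb{N}$ one has $\nu(X^{2n-1})=0$ and $$\nu(X^{2n})=\bigl|\{(\pi,\rho)\in NC(n)^2\mid M_{\pi,\rho}\text{ is strictly non-crossing}\}\bigr|.$$
   Context: $NC(n)$ is the set of non-crossing partitions of $\{1,\dots,n\}$: partitions for which there are no two distinct blocks $V,W$ and $a<b<c<d$ with $a,c\in V$ and $b,d\in W$. For $\pi\in NC(n)$, $P_\pi$ denotes the permutation of $\{1,\dots,n\}$ whose orbits are the blocks of $\pi$ and which performs an increasing cycle on each block: for a block $\{i_1<\dots<i_k\}$, $P_\pi(i_1)=i_2,\dots,P_\pi(i_{k-1})=i_k$, $P_\pi(i_k)=i_1$. For $\pi,\rho\in NC(n)$, the meandric system $M_{\pi,\rho}$ is the permutation of $\{1,\dots,2n\}$ given by $M_{\pi,\rho}(2i-1)=2P_\pi^{-1}(i)$ and $M_{\pi,\rho}(2i)=2P_\rho(i)-1$ for $1\le i\le n$. $M_{\pi,\rho}$ is a meander if it has exactly one orbit. $M_{\pi,\rho}$ is strictly non-crossing if the partition of $\{1,\dots,2n\}$ into orbits of $M_{\pi,\rho}$ is a non-crossing partition, i.e. belongs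 to $NC(2n)$. For a linear functional $\mu:\mathbb{C}[X]\to\mathbb{C}$ with $\mu(1)=1$, the free cumulants $(\kappa_n(\mu))_{n\ge1}$ are the complex numbers uniquely determined by $$\mu(X^n)=\sum_{\pi\in NC(n)}\ \prod_{V\in\pi}\kappa_{|V|}(\mu),\qquad n\in\mathbb{N},$$ the product being over the blocks $V$ of $\pi$. Any sequence of complex numbers is the sequence of free cumulants of a unique such functional. *)

theory Defs
  imports
    Complex_Main
    "HOL-Library.Disjoint_Sets"
    "HOL-Combinatorics.Combinatorics"
    "HOL-Computational_Algebra.Polynomial"
begin

definition NC :: "nat \<Rightarrow> nat set set set" where
  "NC n = {\<pi>. partition_on {1..n} \<pi> \<and>
     \<not> (\<exists>V\<in>\<pi>. \<exists>W\<in>\<pi>. V \<noteq> W \<and>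
        (\<exists>a b c d. a < b \<and> b < c \<and> c < d \<and> a \<in> V \<and> c \<in> V \<and> b \<in> W \<and> d \<in> W))}"

definition block_of :: "nat set set \<Rightarrow> nat \<Rightarrow> nat set" where
  "block_of \<pi> i = (THE V. V \<in> \<pi> \<and> i \<in> V)"

text \<open>The increasing cycle on every block, extended by the identity outside the partitioned set
  so that it permutes that set in the sense of \<^const>\<open>permutes\<close>.\<close>

definition block_perm :: "nat set set \<Rightarrow> nat \<Rightarrow> nat" where
  "block_perm \<pi> i =
     (if i \<in> \<Union>\<pi> then
        (if \<exists>j\<in>block_of \<pi> i. i < j then Min {j \<in> block_of \<pi> i. i < j} else Min (block_of \<pi> i))
      else i)"

text \<open>Odd arguments are \<open>k = 2i - 1\<close>, even ones \<open>k = 2i\<close>. The index \<open>n\<close> is passed explicitly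
  only to make the map the identity outside \<open>{1..2n}\<close>.\<close>

definition meandric_system :: "nat \<Rightarrow> nat set set \<Rightarrow> nat set set \<Rightarrow> nat \<Rightarrow> nat" where
  "meandric_system n \<pi> \<rho> k =
     (if k \<in> {1..2 * n} then
        (if odd k then 2 * inv (block_perm \<pi>) ((k + 1) div 2)
         else 2 * block_perm \<rho> (k div 2) - 1)
      else k)"

definition meandric_orbits :: "nat \<Rightarrow> nat set set \<Rightarrow> nat set set \<Rightarrow> nat set set" where
  "meandric_orbits n \<pi> \<rho> = orbit (meandric_system n \<pi> \<rho>) ` {1..2 * n}"

definition is_meander :: "nat \<Rightarrow> nat set set \<Rightarrow> nat set set \<Rightarrow> bool" where
  "is_meander n \<pi> \<rho> \<longleftrightarrow> card (meandric_orbits n \<pi> \<rho>) = 1"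

definition strictly_noncrossing :: "nat \<Rightarrow> nat set set \<Rightarrow> nat set set \<Rightarrow> bool" where
  "strictly_noncrossing n \<pi> \<rho> \<longleftrightarrow> meandric_orbits n \<pi> \<rho> \<in> NC (2 * n)"

definition meander_number :: "nat \<Rightarrow> nat" where
  "meander_number n = card {(\<pi>, \<rho>). \<pi> \<in> NC n \<and> \<rho> \<in> NC n \<and> is_meander n \<pi> \<rho>}"

text \<open>The moment-cumulant relation constrains \<open>\<kappa> n\<close> only for \<open>n \<ge> 1\<close>; the value at \<open>0\<close> is fixed to
  \<open>0\<close> to make the sequence unique (\<open>free_cumulant_ex1\<close> below).\<close>

definition is_free_cumulants :: "(complex poly \<Rightarrow> complex) \<Rightarrow> (nat \<Rightarrow> complex) \<Rightarrow> bool" where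
  "is_free_cumulants \<mu> \<kappa> \<longleftrightarrow>
     (\<forall>n\<ge>1. \<mu> (monom 1 n) = (\<Sum>\<pi>\<in>NC n. \<Prod>V\<in>\<pi>. \<kappa> (card V)))"

definition free_cumulant :: "(complex poly \<Rightarrow> complex) \<Rightarrow> nat \<Rightarrow> complex" where
  "free_cumulant \<mu> = (THE \<kappa>. \<kappa> 0 = 0 \<and> is_free_cumulants \<mu> \<kappa>)"


lemma NC_partition: "\<pi> \<in> NC n \<Longrightarrow> partition_on {1..n} \<pi>"
  by (simp add: NC_def)

lemma block_of_eq:
  assumes "partition_on A \<pi>" "V \<in> \<pi>" "i \<in> V"
  shows "block_of \<pi> i = V"
  unfolding block_of_def
  using assms partition_onD2[OF assms(1)] by (intro the_equality) (auto simp: disjoint_def)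

lemma block_perm_permutes:
  assumes p: "partition_on {1..n} \<pi>"
  shows "block_perm \<pi> permutes {1..n}"
proof (rule bij_imp_permutes)
  have U: "\<Union>\<pi> = {1..n}" using p by (auto simp: partition_on_def)
  have fin: "finite V" if "V \<in> \<pi>" for V
    using that U by (metis Union_upper finite_atLeastAtMost finite_subset)
  have eq: "block_perm \<pi> i = (if \<exists>j\<in>V. i < j then Min {j \<in> V. i < j} else Min V)"
    if "V \<in> \<pi>" "i \<in> V" for V i
    using that block_of_eq[OF p that] by (auto simp: block_perm_def)
  have mem: "block_perm \<pi> i \<in> V" if V: "V \<in> \<pi>" "i \<in> V" for V i
  proof (cases "\<exists>j\<in>V. i < j")
    case True
    then have "Min {j \<in> V. i < j} \<in> {j \<in> V. i < j}" using fin[OF V(1)] by (intro Min_in) auto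
    then show ?thesis using True by (auto simp: eq[OF V])
  next
    case False
    have "Min V \<in> V" using V(2) fin[OF V(1)] by (intro Min_in) auto
    moreover have "block_perm \<pi> i = Min V" unfolding eq[OF V] using False by (rule if_not_P)
    ultimately show ?thesis by simp
  qed
  have neq: "block_perm \<pi> x \<noteq> block_perm \<pi> y"
    if V: "V \<in> \<pi>" "x \<in> V" "y \<in> V" "x < y" for V x y
  proof -
    have ex: "\<exists>j\<in>V. x < j" using V by blast
    then have fx: "block_perm \<pi> x = Min {j \<in> V. x < j}" by (simp add: eq[OF V(1,2)])
    have fin': "finite {j \<in> V. x < j}" using fin[OF V(1)] by simp
    have "Min {j \<in> V. x < j} \<in> {j \<in> V. x < j}" using ex fin' by (intro Min_in) auto
    then have gt: "x < block_perm \<pi> x" by (simp add: fx)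
    have le: "block_perm \<pi> x \<le> y" unfolding fx using V fin' by (intro Min_le) auto
    show ?thesis
    proof (cases "\<exists>j\<in>V. y < j")
      case True
      then have "Min {j \<in> V. y < j} \<in> {j \<in> V. y < j}" using fin[OF V(1)] by (intro Min_in) auto
      then have "y < block_perm \<pi> y" using True by (simp add: eq[OF V(1,3)])
      then show ?thesis using le by simp
    next
      case False
      then have "block_perm \<pi> y = Min V" unfolding eq[OF V(1,3)] by (rule if_not_P)
      also have "\<dots> \<le> x" using V fin[OF V(1)] by (intro Min_le) auto
      finally show ?thesis using gt by simp
    qed
  qed
  have inj: "inj_on (block_perm \<pi>) {1..n}"
  proof (rule inj_onI)
    fix x y assume xy: "x \<in> {1..n}" "y \<in> {1..n}" and e: "block_perm \<pi> x = block_perm \<pi> y"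
    from xy U obtain V W where V: "V \<in> \<pi>" "x \<in> V" and W: "W \<in> \<pi>" "y \<in> W" by blast
    have "V = W"
      using mem[OF V] mem[OF W] e V W block_of_eq[OF p] by metis
    then show "x = y"
      using neq[OF V(1,2)] neq[OF W] V W e by (metis linorder_neqE_nat)
  qed
  have "block_perm \<pi> ` {1..n} \<subseteq> {1..n}"
    using mem U by blast
  then have "block_perm \<pi> ` {1..n} = {1..n}" using inj by (intro endo_inj_surj) auto
  then show "bij_betw (block_perm \<pi>) {1..n} {1..n}" using inj by (simp add: bij_betw_def)
  show "block_perm \<pi> i = i" if "i \<notin> {1..n}" for i
    using that unfolding block_perm_def U by (rule if_not_P)
qed

lemma finite_NC: "finite (NC n)"
proof (rule finite_subset)
  show "NC n \<subseteq> Pow (Pow {1..n})"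
    by (auto simp: NC_def partition_on_def)
qed simp

lemma one_block_in_NC: "n \<ge> 1 \<Longrightarrow> {{1..n}} \<in> NC n"
  by (auto simp: NC_def partition_on_def disjoint_def)

lemma card_block_less:
  assumes "\<pi> \<in> NC n" "\<pi> \<noteq> {{1..n}}" "V \<in> \<pi>"
  shows "card V < n"
proof -
  have p: "partition_on {1..n} \<pi>" using assms(1) by (rule NC_partition)
  have sub: "V \<subseteq> {1..n}" using p assms(3) by (auto simp: partition_on_def)
  have "V \<noteq> {1..n}"
  proof
    assume V: "V = {1..n}"
    have "W = V" if W: "W \<in> \<pi>" for W
    proof (rule ccontr)
      assume "W \<noteq> V"
      then have "W \<inter> V = {}"
        using partition_onD2[OF p] W assms(3) by (auto simp: disjoint_def)
      moreover have "W \<subseteq> V" using p W V by (auto simp: partition_on_def)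
      moreover have "W \<noteq> {}" using p W by (auto simp: partition_on_def)
      ultimately show False by blast
    qed
    then have "\<pi> = {{1..n}}" using V assms(3) by blast
    with assms(2) show False by simp
  qed
  with sub have "V \<subset> {1..n}" by blast
  then have "card V < card {1..n}" by (intro psubset_card_mono) auto
  then show ?thesis by simp
qed

lemma sum_NC_split:
  fixes \<kappa> :: "nat \<Rightarrow> complex"
  assumes "n \<ge> 1"
  shows "(\<Sum>\<pi>\<in>NC n. \<Prod>V\<in>\<pi>. \<kappa> (card V)) =
    \<kappa> n + (\<Sum>\<pi>\<in>NC n - {{{1..n}}}. \<Prod>V\<in>\<pi>. \<kappa> (card V))"
  using sum.remove[OF finite_NC one_block_in_NC[OF assms], of "\<lambda>\<pi>. \<Prod>V\<in>\<pi>. \<kappa> (card V)"]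
  by simp

function cumulant_rec :: "(nat \<Rightarrow> complex) \<Rightarrow> nat \<Rightarrow> complex" where
  "cumulant_rec m n = (if n = 0 then 0 else
     m n - (\<Sum>\<pi>\<in>NC n - {{{1..n}}}. \<Prod>V\<in>\<pi>. cumulant_rec m (card V)))"
  by auto
termination
  by (relation "measure snd") (use card_block_less in auto)

declare cumulant_rec.simps [simp del]

lemma is_free_cumulants_unique:
  assumes "is_free_cumulants \<mu> \<kappa>" "is_free_cumulants \<mu> \<kappa>'" "n \<ge> 1"
  shows "\<kappa> n = \<kappa>' n"
  using assms(3)
proof (induction n rule: less_induct)
  case (less n)
  have "(\<Prod>V\<in>\<pi>. \<kappa> (card V)) = (\<Prod>V\<in>\<pi>. \<kappa>' (card V))" if "\<pi> \<in> NC n - {{{1..n}}}" for \<pi>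
  proof (rule prod.cong[OF refl])
    fix V assume V: "V \<in> \<pi>"
    have p: "partition_on {1..n} \<pi>" using that by (intro NC_partition) blast
    have "V \<subseteq> {1..n}" "V \<noteq> {}" using p V by (auto simp: partition_on_def)
    then have "card V \<ge> 1"
      by (metis One_nat_def Suc_leI card_gt_0_iff finite_atLeastAtMost finite_subset)
    moreover have "card V < n" using card_block_less that V by auto
    ultimately show "\<kappa> (card V) = \<kappa>' (card V)" using less.IH by simp
  qed
  then have "(\<Sum>\<pi>\<in>NC n - {{{1..n}}}. \<Prod>V\<in>\<pi>. \<kappa> (card V)) =
     (\<Sum>\<pi>\<in>NC n - {{{1..n}}}. \<Prod>V\<in>\<pi>. \<kappa>' (card V))"
    by (intro sum.cong) auto
  moreover have "(\<Sum>\<pi>\<in>NC n. \<Prod>V\<in>\<pi>. \<kappa> (card V)) = (\<Sum>\<pi>\<in>NC n. \<Prod>V\<in>\<pi>. \<kappa>' (card V))"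
    using assms(1,2) less.prems by (auto simp: is_free_cumulants_def)
  ultimately show ?case
    using sum_NC_split[OF less.prems, of \<kappa>] sum_NC_split[OF less.prems, of \<kappa>'] by simp
qed

lemma free_cumulant_ex1: "\<exists>!\<kappa>. \<kappa> 0 = 0 \<and> is_free_cumulants \<mu> \<kappa>"
proof (rule ex_ex1I)
  let ?k = "cumulant_rec (\<lambda>n. \<mu> (monom 1 n))"
  have "is_free_cumulants \<mu> ?k"
    unfolding is_free_cumulants_def
  proof (intro allI impI)
    fix n :: nat assume n: "1 \<le> n"
    show "\<mu> (monom 1 n) = (\<Sum>\<pi>\<in>NC n. \<Prod>V\<in>\<pi>. ?k (card V))"
      unfolding sum_NC_split[OF n]
      using n by (subst cumulant_rec.simps) simp
  qed
  then show "\<exists>\<kappa>. \<kappa> 0 = 0 \<and> is_free_cumulants \<mu> \<kappa>"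
    by (intro exI[of _ ?k]) (simp add: cumulant_rec.simps)
next
  fix \<kappa> \<kappa>' :: "nat \<Rightarrow> complex"
  assume a: "\<kappa> 0 = 0 \<and> is_free_cumulants \<mu> \<kappa>" "\<kappa>' 0 = 0 \<and> is_free_cumulants \<mu> \<kappa>'"
  show "\<kappa> = \<kappa>'"
  proof
    fix n show "\<kappa> n = \<kappa>' n"
      using a is_free_cumulants_unique[of \<mu> \<kappa> \<kappa>' n] by (cases "n = 0") auto
  qed
qed

lemma is_free_cumulants_free_cumulant: "is_free_cumulants \<mu> (free_cumulant \<mu>)"
  using theI'[OF free_cumulant_ex1[of \<mu>]] unfolding free_cumulant_def by blast

lemma free_cumulant_eqI:
  "is_free_cumulants \<mu> \<kappa> \<Longrightarrow> n \<ge> 1 \<Longrightarrow> free_cumulant \<mu> n = \<kappa> n"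
  using is_free_cumulants_unique is_free_cumulants_free_cumulant by blast

lemma functional_with_free_cumulants:
  fixes \<kappa> :: "nat \<Rightarrow> complex"
  shows "\<exists>\<nu>. Vector_Spaces.linear smult (*) \<nu> \<and> \<nu> 1 = 1 \<and> (\<forall>n\<ge>1. free_cumulant \<nu> n = \<kappa> n)"
proof -
  define m :: "nat \<Rightarrow> complex" where
    "m n = (if n = 0 then 1 else (\<Sum>\<pi>\<in>NC n. \<Prod>V\<in>\<pi>. \<kappa> (card V)))" for n
  define \<nu> :: "complex poly \<Rightarrow> complex" where "\<nu> p = (\<Sum>i\<le>degree p. coeff p i * m i)" for p
  have ext: "\<nu> p = (\<Sum>i\<le>N. coeff p i * m i)" if "degree p \<le> N" for p N
    unfolding \<nu>_def using that
    by (intro sum.mono_neutral_left) (auto simp: coeff_eq_0)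
  have add: "\<nu> (p + q) = \<nu> p + \<nu> q" for p q
  proof -
    define N where "N = max (degree p) (degree q)"
    have "degree p \<le> N" "degree q \<le> N" "degree (p + q) \<le> N"
      by (auto simp: N_def degree_add_le_max)
    then show ?thesis by (simp add: ext algebra_simps sum.distrib)
  qed
  have scale: "\<nu> (smult c p) = c * \<nu> p" for c p
    using ext[of "smult c p" "degree p"] ext[of p "degree p"]
    by (simp add: degree_smult_le sum_distrib_left mult.assoc)
  have mon: "\<nu> (monom 1 n) = m n" for n
  proof -
    have "\<nu> (monom 1 n) = (\<Sum>i\<le>n. if i = n then m i else 0)"
      unfolding ext[OF degree_monom_le] by (intro sum.cong) auto
    then show ?thesis by simp
  qed
  have "Vector_Spaces.linear smult (*) \<nu>"
    by unfold_locales (auto simp: add scale algebra_simps smult_add_left smult_add_right)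
  moreover have "\<nu> 1 = 1" using mon[of 0] by (simp add: m_def flip: one_poly_eq_simps)
  moreover have "is_free_cumulants \<nu> \<kappa>"
    unfolding is_free_cumulants_def by (simp add: mon m_def)
  ultimately show ?thesis using free_cumulant_eqI by blast
qed

end

theory Submission
  imports Defs
begin

text \<open>
  Doubling every point \<open>i\<close> to \<open>2i - 1, 2i\<close> turns a non-crossing partition of \<open>{1..n}\<close> into a
  non-crossing pairing of \<open>{1..2n}\<close>, and this is a bijection. The meandric system follows the
  pairing of \<open>\<pi>\<close> on odd points and that of \<open>\<rho>\<close> on even points, so its orbits are the minimal
  sets closed under both pairings. A pair of non-crossing pairings whose orbit partition is a given non-crossing \<open>\<sigma>\<close> is
  the same as a choice, for every block of \<open>\<sigma>\<close>, of a pair of non-crossing pairings that connects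
  this block. Hence summing the product of meander numbers over all \<open>\<sigma>\<close>, which is the
  moment-cumulant formula, counts the strictly non-crossing systems.
\<close>

section \<open>Non-crossing pairings\<close>

text \<open>A pairing is encoded as the fixed-point-free involution that swaps the two ends of each
  arc. Being the identity outside \<open>S\<close>, it is determined by its arcs, so counting
  functions is counting pairings.\<close>

definition nc_pairings :: "nat set \<Rightarrow> (nat \<Rightarrow> nat) set" where
  "nc_pairings S = {f. (\<forall>x\<in>S. f x \<in> S \<and> f x \<noteq> x \<and> f (f x) = x) \<and> (\<forall>x. x \<notin> S \<longrightarrow> f x = x) \<and>
     \<not> (\<exists>a\<in>S. \<exists>b\<in>S. a < b \<and> b < f a \<and> f a < f b)}"

text \<open>For pairings \<open>f\<close> and \<open>g\<close> this says that \<open>V\<close> is an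
  orbit of the group they generate, that is, one closed curve made of arcs. Unlike a meandric
  system, the formulation by minimal closed sets does not refer to the parity of points, so it makes
  sense on an arbitrary block of a partition.\<close>

definition connects :: "('a \<Rightarrow> 'a) \<Rightarrow> ('a \<Rightarrow> 'a) \<Rightarrow> 'a set \<Rightarrow> bool" where
  "connects f g V \<longleftrightarrow> V \<noteq> {} \<and> f ` V \<subseteq> V \<and> g ` V \<subseteq> V \<and>
     (\<forall>U\<subseteq>V. U \<noteq> {} \<longrightarrow> f ` U \<subseteq> U \<longrightarrow> g ` U \<subseteq> U \<longrightarrow> U = V)"

definition connected_pairs :: "nat set \<Rightarrow> ((nat \<Rightarrow> nat) \<times> (nat \<Rightarrow> nat)) set" where
  "connected_pairs S = {(f, g). f \<in> nc_pairings S \<and> g \<in> nc_pairings S \<and> connects f g S}"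

lemma connectsD:
  assumes "connects f g V"
  shows "V \<noteq> {}" "x \<in> V \<Longrightarrow> f x \<in> V" "x \<in> V \<Longrightarrow> g x \<in> V"
    "U \<subseteq> V \<Longrightarrow> U \<noteq> {} \<Longrightarrow> f ` U \<subseteq> U \<Longrightarrow> g ` U \<subseteq> U \<Longrightarrow> U = V"
  using assms by (auto simp: connects_def)

lemma nc_pairingsI:
  assumes "\<And>x. x \<in> S \<Longrightarrow> f x \<in> S" "\<And>x. x \<in> S \<Longrightarrow> f x \<noteq> x" "\<And>x. x \<in> S \<Longrightarrow> f (f x) = x"
    "\<And>x. x \<notin> S \<Longrightarrow> f x = x"
    "\<And>a b. a \<in> S \<Longrightarrow> b \<in> S \<Longrightarrow> a < b \<Longrightarrow> b < f a \<Longrightarrow> f a < f b \<Longrightarrow> False"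
  shows "f \<in> nc_pairings S"
  unfolding nc_pairings_def using assms by blast

text \<open>The involution law \<open>f (f x) = x\<close> carries no membership condition because
  \<open>f\<close> is the identity outside \<open>S\<close>.\<close>

lemma nc_pairingsD:
  assumes "f \<in> nc_pairings S"
  shows "x \<in> S \<Longrightarrow> f x \<in> S" "x \<in> S \<Longrightarrow> f x \<noteq> x" "f (f x) = x" "x \<notin> S \<Longrightarrow> f x = x"
    "a \<in> S \<Longrightarrow> b \<in> S \<Longrightarrow> a < b \<Longrightarrow> b < f a \<Longrightarrow> f a < f b \<Longrightarrow> False"
  using assms unfolding nc_pairings_def by (blast, blast, cases "x \<in> S", auto)

lemma nc_pairings_permutes:
  assumes "f \<in> nc_pairings S"
  shows "f permutes S"
  unfolding permutes_def using nc_pairingsD(3,4)[OF assms] by metis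

lemma finite_nc_pairings: "finite S \<Longrightarrow> finite (nc_pairings S)"
  by (rule finite_subset[OF _ finite_permutations[of S]]) (auto intro: nc_pairings_permutes)

lemma finite_connected_pairs: "finite S \<Longrightarrow> finite (connected_pairs S)"
  by (rule finite_subset[of _ "nc_pairings S \<times> nc_pairings S"])
    (auto simp: connected_pairs_def finite_nc_pairings)

text \<open>An arc that starts under another arc also ends under it. The partner of \<open>b\<close>
  is neither \<open>a\<close> nor \<open>f a\<close> since \<open>f\<close> is an involution. Ending
  right of \<open>f a\<close> is a crossing read from \<open>a\<close>, ending left of
  \<open>a\<close> is a crossing read from \<open>f b\<close>.\<close>

lemma nc_pairings_between:
  assumes f: "f \<in> nc_pairings S" and "a \<in> S" "b \<in> S" "a < b" "b < f a"
  shows "a < f b" "f b < f a"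
proof -
  note D = nc_pairingsD[OF f]
  have ne: "f b \<noteq> a" "f b \<noteq> f a" using D(3) assms by (metis less_irrefl)+
  show "f b < f a" using D(5)[of a b] ne assms by force
  show "a < f b"
  proof (rule ccontr)
    assume "\<not> a < f b"
    then have "f b < a" using ne by simp
    then show False using D(5)[of "f b" a] D(1)[of b] D(3)[of b] assms by auto
  qed
qed

lemma NC_crossing:
  assumes "\<pi> \<in> NC n" "V \<in> \<pi>" "W \<in> \<pi>" "a < b" "b < c" "c < d" "a \<in> V" "b \<in> W" "c \<in> V" "d \<in> W"
  shows "V = W"
proof (rule ccontr)
  assume "V \<noteq> W"
  then have "\<exists>V\<in>\<pi>. \<exists>W\<in>\<pi>. V \<noteq> W \<and>
      (\<exists>a b c d. a < b \<and> b < c \<and> c < d \<and> a \<in> V \<and> c \<in> V \<and> b \<in> W \<and> d \<in> W)"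
    using assms(2-) by (intro bexI[of _ V] bexI[of _ W] conjI exI[of _ a] exI[of _ b] exI[of _ c] exI[of _ d])
  then show False using assms(1) unfolding NC_def mem_Collect_eq by (elim conjE notE)
qed

section \<open>Parity in pairings\<close>

text \<open>The order picks the smaller point of each pair; these points and their partners form two
  disjoint sets of equal size.\<close>

lemma even_card_involution:
  fixes f :: "'a::linorder \<Rightarrow> 'a"
  assumes "finite S" and f: "\<And>x. x \<in> S \<Longrightarrow> f x \<in> S \<and> f x \<noteq> x \<and> f (f x) = x"
  shows "even (card S)"
proof -
  define A where "A = {x \<in> S. x < f x}"
  have "S = A \<union> f ` A"
  proof (intro equalityI subsetI)
    fix x assume x: "x \<in> S"
    show "x \<in> A \<union> f ` A"
    proof (cases "x < f x")
      case False
      then have "f x \<in> A" using f[OF x] f[of "f x"] x by (auto simp: A_def)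
      then show ?thesis using f[OF x] by (metis UnI2 imageI)
    qed (use x A_def in auto)
  qed (use f A_def in auto)
  moreover have "A \<inter> f ` A = {}" using f by (force simp: A_def)
  moreover have "inj_on f A" using f by (metis (no_types, lifting) A_def inj_onI mem_Collect_eq)
  ultimately have "card S = card A + card A"
    using assms(1) by (metis card_Un_disjoint card_image finite_Un)
  then show ?thesis by simp
qed

text \<open>The points strictly under an arc are paired among themselves, so their number is even
  and the two ends of the arc have opposite parity. This is why following two pairings alternately
  amounts to choosing the pairing by the parity of the current point.\<close>

lemma nc_pairings_parity:
  assumes f: "f \<in> nc_pairings {1..N}" and x: "x \<in> {1..N}"
  shows "even (f x) \<longleftrightarrow> odd x"
proof -
  note D = nc_pairingsD[OF f]
  have *: "even (f a) \<longleftrightarrow> odd a" if a: "a \<in> {1..N}" "a < f a" for a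
  proof -
    have fa: "f a \<in> {1..N}" using D(1) a by blast
    have "even (card {a<..<f a})"
    proof (rule even_card_involution[of _ f])
      fix b assume b: "b \<in> {a<..<f a}"
      then have bS: "b \<in> {1..N}" using a fa by auto
      show "f b \<in> {a<..<f a} \<and> f b \<noteq> b \<and> f (f b) = b"
        using nc_pairings_between[OF f a(1) bS] b D(2)[OF bS] D(3)[of b] by auto
    qed simp
    then show ?thesis using a(2) by (auto simp: even_diff_nat)
  qed
  show ?thesis
  proof (cases "x < f x")
    case False
    then have "f x < f (f x)" using D(2)[OF x] D(3)[of x] by auto
    then show ?thesis using *[of "f x"] D(1)[OF x] D(3)[of x] by auto
  qed (use * x in auto)
qed

lemma nc_pairings_odd:
  assumes "finite S" "odd (card S)"
  shows "nc_pairings S = {}"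
proof (rule equals0I)
  fix f assume f: "f \<in> nc_pairings S"
  have "even (card S)"
    by (rule even_card_involution[OF assms(1), of f]) (simp add: nc_pairingsD[OF f])
  then show False using assms(2) by simp
qed

section \<open>Partitions into connected blocks\<close>

text \<open>When a block of \<open>\<sigma>\<close> meets a block of \<open>\<tau>\<close>, their
  intersection is closed under both maps, so minimality makes it equal to each of them. Used in both
  directions, this shows that a pair of pairings determines its partition into connected
  blocks.\<close>

lemma connects_partition_unique:
  assumes "partition_on S \<sigma>" "partition_on S \<tau>" "\<forall>V\<in>\<sigma>. connects f g V" "\<forall>V\<in>\<tau>. connects f g V"
  shows "\<sigma> \<subseteq> \<tau>"
proof
  fix V assume V: "V \<in> \<sigma>"
  then have cV: "connects f g V" using assms by blast
  then obtain x where x: "x \<in> V" by (auto simp: connects_def)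
  then have "x \<in> S" using assms(1) V by (auto simp: partition_on_def)
  then obtain W where W: "W \<in> \<tau>" "x \<in> W" using assms(2) by (auto simp: partition_on_def)
  then have cW: "connects f g W" using assms by blast
  define U where "U = V \<inter> W"
  have "f ` U \<subseteq> U" "g ` U \<subseteq> U"
    using connectsD(2,3)[OF cV] connectsD(2,3)[OF cW] by (auto simp: U_def)
  moreover have "U \<noteq> {}" "U \<subseteq> V" "U \<subseteq> W" using x W by (auto simp: U_def)
  ultimately have "U = V" "U = W" by (simp_all add: connectsD(4)[OF cV] connectsD(4)[OF cW])
  then show "V \<in> \<tau>" using W by blast
qed

lemma connects_cong:
  assumes "\<And>x. x \<in> V \<Longrightarrow> f x = f' x" "\<And>x. x \<in> V \<Longrightarrow> g x = g' x"
  shows "connects f g V \<longleftrightarrow> connects f' g' V"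
proof -
  have "f ` U = f' ` U" "g ` U = g' ` U" if "U \<subseteq> V" for U
    using that assms by (auto intro!: image_cong)
  then show ?thesis unfolding connects_def by (metis order_refl)
qed

section \<open>Invariance under order isomorphisms\<close>

text \<open>Conjugation by an increasing bijection preserves crossings and closed sets, hence maps
  connected pairs injectively to connected pairs. The inequality is enough, since it will be applied
  in both directions.\<close>

lemma card_connected_pairs_le:
  assumes h: "strict_mono_on A h" "h ` A = B" and fin: "finite B"
  shows "card (connected_pairs A) \<le> card (connected_pairs B)"
proof -
  define k where "k = inv_into A h"
  \<comment> \<open>Conjugation by \<open>h\<close>, reset to the identity outside \<open>B\<close>
    as \<open>nc_pairings\<close> demands.\<close>
  define c where "c f y = (if y \<in> B then h (f (k y)) else y)" for f y
  have inj: "inj_on h A" using h(1) by (rule strict_mono_on_imp_inj_on)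
  have hB: "h x \<in> B" and kh: "k (h x) = x" if "x \<in> A" for x
    using that h(2) inj by (auto simp: k_def)
  have kA: "k y \<in> A" and hk: "h (k y) = y" if "y \<in> B" for y
    using that h(2) by (auto simp: k_def inv_into_into f_inv_into_f)
  have mono: "k x < k y" if "x \<in> B" "y \<in> B" "x < y" for x y
    using that kA hk strict_mono_on_less[OF h(1), of "k x" "k y"] by simp
  have c_nc: "c f \<in> nc_pairings B" if f: "f \<in> nc_pairings A" for f
  proof (rule nc_pairingsI)
    note D = nc_pairingsD[OF f]
    fix x assume x: "x \<in> B"
    show "c f x \<in> B" using x kA hB D(1) by (simp add: c_def)
    show "c f x \<noteq> x" using x kA hk D(1,2) kh by (metis c_def)
    show "c f (c f x) = x" using x kA hB hk kh D(1,3) by (simp add: c_def)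
  next
    note D = nc_pairingsD[OF f]
    fix a b assume ab: "a \<in> B" "b \<in> B" "a < b" "b < c f a" "c f a < c f b"
    have kc: "k (c f y) = f (k y)" "c f y \<in> B" if "y \<in> B" for y
      using that kA kh hB D(1) by (auto simp: c_def)
    show False
      using D(5)[of "k a" "k b"] kA[OF ab(1)] kA[OF ab(2)] mono[OF _ _ ab(3)]
        mono[OF _ _ ab(4)] mono[OF _ _ ab(5)] kc ab by simp
  qed (auto simp: c_def)
  have c_con: "connects (c f) (c g) B"
    if f: "f \<in> nc_pairings A" and g: "g \<in> nc_pairings A" and con: "connects f g A" for f g
    unfolding connects_def
  proof (intro conjI allI impI)
    show "B \<noteq> {}" using connectsD(1)[OF con] h(2) by blast
    show "c f ` B \<subseteq> B" "c g ` B \<subseteq> B"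
      using nc_pairingsD(1)[OF c_nc[OF f]] nc_pairingsD(1)[OF c_nc[OF g]] by auto
    fix U assume U: "U \<subseteq> B" "U \<noteq> {}" "c f ` U \<subseteq> U" "c g ` U \<subseteq> U"
    have cl: "e ` (k ` U) \<subseteq> k ` U" if e: "e \<in> nc_pairings A" and "c e ` U \<subseteq> U" for e
    proof clarify
      fix u assume u: "u \<in> U"
      then have "c e u \<in> U" "u \<in> B" using that(2) U(1) by auto
      moreover from this have "k (c e u) = e (k u)"
        using kA kh nc_pairingsD(1)[OF e] by (simp add: c_def)
      ultimately show "e (k u) \<in> k ` U" by (metis imageI)
    qed
    have "k ` U = A"
      using U kA cl[OF f] cl[OF g] by (intro connectsD(4)[OF con]) auto
    then have "h ` k ` U = B" using h(2) by simp
    moreover have "h ` k ` U = U" using U(1) hk by (force simp: image_image)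
    ultimately show "U = B" by simp
  qed
  have c_inj: "f = f'" if f: "f \<in> nc_pairings A" "f' \<in> nc_pairings A" and eq: "c f = c f'" for f f'
  proof
    fix x
    show "f x = f' x"
    proof (cases "x \<in> A")
      case True
      have "c f (h x) = c f' (h x)" by (simp add: eq)
      then have "h (f x) = h (f' x)" using True hB kh by (simp add: c_def)
      then show ?thesis
        using True inj nc_pairingsD(1)[OF f(1)] nc_pairingsD(1)[OF f(2)] by (simp add: inj_on_eq_iff)
    qed (simp add: nc_pairingsD(4)[OF f(1)] nc_pairingsD(4)[OF f(2)])
  qed
  show ?thesis
  proof (rule card_inj_on_le)
    show "inj_on (map_prod c c) (connected_pairs A)"
      by (auto simp: inj_on_def connected_pairs_def dest: c_inj)
    show "map_prod c c ` connected_pairs A \<subseteq> connected_pairs B"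
      by (auto simp: connected_pairs_def c_nc c_con)
  qed (rule finite_connected_pairs[OF fin])
qed

text \<open>Finite sets of equal size are order isomorphic through their increasing enumerations.
  Hence the weight of a block depends on its size alone, as required of a cumulant.\<close>

lemma card_connected_pairs_cong:
  assumes "finite V" "finite W" "card V = card W"
  shows "card (connected_pairs V) = card (connected_pairs W)"
proof -
  have le: "card (connected_pairs V) \<le> card (connected_pairs W)"
    if fin: "finite V" "finite W" and eq: "card V = card W" for V W
  proof -
    obtain h where h: "bij_betw h {..<card V} V" "strict_mono_on {..<card V} h"
      using ex_bij_betw_strict_mono_card[OF fin(1)] .
    obtain h' where h': "bij_betw h' {..<card V} W" "strict_mono_on {..<card V} h'"
      using ex_bij_betw_strict_mono_card[OF fin(2)] unfolding eq .
    define k where "k = inv_into {..<card V} h"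
    have "h ` {..<card V} = V" using h(1) by (rule bij_betw_imp_surj_on)
    then have k: "k x \<in> {..<card V}" "h (k x) = x" if "x \<in> V" for x
      using that unfolding k_def by (metis inv_into_into, metis f_inv_into_f)
    have "strict_mono_on V (h' \<circ> k)"
    proof (rule strict_mono_onI)
      fix x y assume xy: "x \<in> V" "y \<in> V" "x < y"
      then have "k x < k y" using k strict_mono_on_less[OF h(2), of "k x" "k y"] by simp
      then show "(h' \<circ> k) x < (h' \<circ> k) y"
        using strict_mono_onD[OF h'(2)] k xy by simp
    qed
    moreover have "bij_betw (h' \<circ> k) V W"
      using bij_betw_trans[OF bij_betw_inv_into[OF h(1)] h'(1)] by (simp add: k_def)
    ultimately show ?thesis
      using fin(2) by (intro card_connected_pairs_le[of V "h' \<circ> k"] bij_betw_imp_surj_on)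
  qed
  show ?thesis using assms by (intro antisym le) auto
qed

section \<open>Gluing pairings along a non-crossing partition\<close>

text \<open>Restriction to the blocks and gluing over them are mutually inverse. Restriction yields
  pairings because a connected block is closed under both maps; gluing yields non-crossing pairings
  because \<open>\<sigma>\<close> is non-crossing.\<close>

lemma card_pairs_connecting_blocks:
  assumes \<sigma>: "\<sigma> \<in> NC N"
  shows "card {(f, g). f \<in> nc_pairings {1..N} \<and> g \<in> nc_pairings {1..N} \<and> (\<forall>V\<in>\<sigma>. connects f g V)} =
    (\<Prod>V\<in>\<sigma>. card (connected_pairs V))" (is "card ?X = _")
proof -
  note p = NC_partition[OF \<sigma>]
  have U: "\<Union>\<sigma> = {1..N}" using p by (auto simp: partition_on_def)
  have sub: "V \<subseteq> {1..N}" if "V \<in> \<sigma>" for V using that U by blast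
  have bl: "block_of \<sigma> x \<in> \<sigma>" "x \<in> block_of \<sigma> x" if x: "x \<in> {1..N}" for x
  proof -
    obtain V where V: "V \<in> \<sigma>" "x \<in> V" using x U by blast
    then show "block_of \<sigma> x \<in> \<sigma>" "x \<in> block_of \<sigma> x" using block_of_eq[OF p V] by auto
  qed
  have fin\<sigma>: "finite \<sigma>" using finite_elements[OF _ p] by simp
  define split where
    "split = (\<lambda>(f, g). \<lambda>V\<in>\<sigma>. (perm_restrict f V, perm_restrict g V :: nat \<Rightarrow> nat))"
  define glue where
    "glue F x = (if x \<in> {1..N} then F (block_of \<sigma> x) x else x)" for F :: "nat set \<Rightarrow> nat \<Rightarrow> nat" and x
  have restr: "perm_restrict f V \<in> nc_pairings V"
    if f: "f \<in> nc_pairings {1..N}" and V: "V \<in> \<sigma>" "\<And>x. x \<in> V \<Longrightarrow> f x \<in> V" for f V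
  proof (rule nc_pairingsI)
    fix a b assume ab: "a \<in> V" "b \<in> V" "a < b" "b < perm_restrict f V a"
      "perm_restrict f V a < perm_restrict f V b"
    then have "a \<in> {1..N}" "b \<in> {1..N}" using sub[OF V(1)] by blast+
    then show False using nc_pairingsD(5)[OF f, of a b] ab by (simp add: perm_restrict_def)
  qed (use nc_pairingsD[OF f] sub[OF V(1)] V(2) in \<open>auto simp: perm_restrict_def\<close>)
  have glue_block: "glue F x = F V x" if "V \<in> \<sigma>" "x \<in> V" for F V x
    using block_of_eq[OF p that] sub[OF that(1)] that by (auto simp: glue_def)
  have glue_nc: "glue F \<in> nc_pairings {1..N}" if F: "\<And>V. V \<in> \<sigma> \<Longrightarrow> F V \<in> nc_pairings V" for F
  proof (rule nc_pairingsI)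
    fix x assume x: "x \<in> {1..N}"
    define V where "V = block_of \<sigma> x"
    have V: "V \<in> \<sigma>" "x \<in> V" using bl[OF x] by (auto simp: V_def)
    note D = nc_pairingsD[OF F[OF V(1)]]
    note gb = glue_block[OF V(1), of _ F]
    show "glue F x \<in> {1..N}" using gb[OF V(2)] D(1)[OF V(2)] sub[OF V(1)] by (metis subsetD)
    show "glue F x \<noteq> x" using gb D(2) V by auto
    show "glue F (glue F x) = x" using gb D(1,3) V by auto
  next
    fix a b assume ab: "a \<in> {1..N}" "b \<in> {1..N}" "a < b" "b < glue F a" "glue F a < glue F b"
    define V W where "V = block_of \<sigma> a" and "W = block_of \<sigma> b"
    have V: "V \<in> \<sigma>" "a \<in> V" and W: "W \<in> \<sigma>" "b \<in> W" using bl ab by (auto simp: V_def W_def)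
    have ga: "glue F a = F V a" "F V a \<in> V" and gb: "glue F b = F W b" "F W b \<in> W"
      using glue_block V W nc_pairingsD(1)[OF F] by auto
    \<comment> \<open>Crossing arcs from different blocks would make these blocks cross, so both
      arcs lie in one block, where the given pairing has no crossing.\<close>
    have "V = W"
      using NC_crossing[OF \<sigma> V(1) W(1) ab(3) _ _ V(2) W(2), of "F V a" "F W b"] ab ga gb by simp
    then show False using nc_pairingsD(5)[OF F[OF V(1)], of a b] ab ga gb V W by simp
  qed (auto simp: glue_def)
  have "bij_betw split ?X (PiE \<sigma> connected_pairs)"
  proof (rule bij_betw_byWitness[where f' = "\<lambda>F. (glue (\<lambda>V. fst (F V)), glue (\<lambda>V. snd (F V)))"])
    show "\<forall>p\<in>?X. (glue (\<lambda>V. fst (split p V)), glue (\<lambda>V. snd (split p V))) = p"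
    proof
      fix p assume "p \<in> ?X"
      then obtain f g where fg: "p = (f, g)" and f: "f \<in> nc_pairings {1..N}" and g: "g \<in> nc_pairings {1..N}"
        by blast
      have "glue (\<lambda>V. fst (split (f, g) V)) = f"
        by (rule ext) (auto simp: glue_def split_def bl perm_restrict_def nc_pairingsD(4)[OF f])
      moreover have "glue (\<lambda>V. snd (split (f, g) V)) = g"
        by (rule ext) (auto simp: glue_def split_def bl perm_restrict_def nc_pairingsD(4)[OF g])
      ultimately show "(glue (\<lambda>V. fst (split p V)), glue (\<lambda>V. snd (split p V))) = p"
        by (simp add: fg)
    qed
    show "\<forall>F\<in>PiE \<sigma> connected_pairs. split (glue (\<lambda>V. fst (F V)), glue (\<lambda>V. snd (F V))) = F"
    proof
      fix F assume F: "F \<in> PiE \<sigma> connected_pairs"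
      show "split (glue (\<lambda>V. fst (F V)), glue (\<lambda>V. snd (F V))) = F"
      proof
        fix V
        show "split (glue (\<lambda>V. fst (F V)), glue (\<lambda>V. snd (F V))) V = F V"
        proof (cases "V \<in> \<sigma>")
          case True
          then have "F V \<in> connected_pairs V" using F by auto
          then have m: "fst (F V) \<in> nc_pairings V" "snd (F V) \<in> nc_pairings V"
            by (auto simp: connected_pairs_def)
          have "perm_restrict (glue (\<lambda>V. fst (F V))) V = fst (F V)"
            using True by (auto simp: perm_restrict_def glue_block nc_pairingsD(4)[OF m(1)])
          moreover have "perm_restrict (glue (\<lambda>V. snd (F V))) V = snd (F V)"
            using True by (auto simp: perm_restrict_def glue_block nc_pairingsD(4)[OF m(2)])
          ultimately show ?thesis using True by (simp add: split_def)
        qed (use F in \<open>auto simp: split_def\<close>)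
      qed
    qed
    show "split ` ?X \<subseteq> PiE \<sigma> connected_pairs"
    proof clarify
      fix f g assume f: "f \<in> nc_pairings {1..N}" and g: "g \<in> nc_pairings {1..N}"
        and con: "\<forall>V\<in>\<sigma>. connects f g V"
      have "(perm_restrict f V, perm_restrict g V) \<in> connected_pairs V" if V: "V \<in> \<sigma>" for V
      proof -
        have "connects (perm_restrict f V) (perm_restrict g V) V \<longleftrightarrow> connects f g V"
          by (rule connects_cong) (auto simp: perm_restrict_def)
        moreover have cV: "connects f g V" using con V by blast
        moreover have "perm_restrict f V \<in> nc_pairings V" "perm_restrict g V \<in> nc_pairings V"
          by (rule restr[OF f V connectsD(2)[OF cV]], assumption)
            (rule restr[OF g V connectsD(3)[OF cV]], assumption)
        ultimately show ?thesis by (simp add: connected_pairs_def)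
      qed
      then show "split (f, g) \<in> PiE \<sigma> connected_pairs" by (auto simp: split_def)
    qed
    show "(\<lambda>F. (glue (\<lambda>V. fst (F V)), glue (\<lambda>V. snd (F V)))) ` PiE \<sigma> connected_pairs \<subseteq> ?X"
    proof clarify
      fix F assume "F \<in> PiE \<sigma> connected_pairs"
      then have F: "F V \<in> connected_pairs V" if "V \<in> \<sigma>" for V using that by auto
      then have m: "fst (F V) \<in> nc_pairings V" "snd (F V) \<in> nc_pairings V"
        "connects (fst (F V)) (snd (F V)) V" if "V \<in> \<sigma>" for V
        using that by (simp_all add: connected_pairs_def case_prod_beta)
      show "glue (\<lambda>V. fst (F V)) \<in> nc_pairings {1..N} \<and> glue (\<lambda>V. snd (F V)) \<in> nc_pairings {1..N} \<and>
         (\<forall>V\<in>\<sigma>. connects (glue (\<lambda>V. fst (F V))) (glue (\<lambda>V. snd (F V))) V)"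
      proof (intro conjI ballI glue_nc m)
        fix V assume V: "V \<in> \<sigma>"
        show "connects (glue (\<lambda>V. fst (F V))) (glue (\<lambda>V. snd (F V))) V"
          using connects_cong[of V "fst (F V)" "glue (\<lambda>V. fst (F V))" "snd (F V)" "glue (\<lambda>V. snd (F V))"]
            m(3)[OF V] by (simp add: glue_block[OF V])
      qed
    qed
  qed
  then show ?thesis by (simp add: bij_betw_same_card card_PiE[OF fin\<sigma>])
qed

text \<open>This is the moment-cumulant sum for the weights
  \<open>card (connected_pairs {1..k})\<close>. Each product counts the pairs whose connected blocks
  are those of \<open>\<sigma>\<close>, and different \<open>\<sigma>\<close> give disjoint sets of
  pairs by \<open>connects_partition_unique\<close>.\<close>

lemma sum_NC_prod_connected_pairs:
  "(\<Sum>\<sigma>\<in>NC N. \<Prod>V\<in>\<sigma>. card (connected_pairs {1..card V})) =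
    card {(f, g). f \<in> nc_pairings {1..N} \<and> g \<in> nc_pairings {1..N} \<and> (\<exists>\<sigma>\<in>NC N. \<forall>V\<in>\<sigma>. connects f g V)}"
    (is "_ = card ?Y")
proof -
  let ?X = "\<lambda>\<sigma>. {(f, g). f \<in> nc_pairings {1..N} \<and> g \<in> nc_pairings {1..N} \<and> (\<forall>V\<in>\<sigma>. connects f g V)}"
  have "(\<Prod>V\<in>\<sigma>. card (connected_pairs {1..card V})) = card (?X \<sigma>)" if \<sigma>: "\<sigma> \<in> NC N" for \<sigma>
  proof -
    have "finite V" if "V \<in> \<sigma>" for V
      using that NC_partition[OF \<sigma>] by (metis Union_upper finite_atLeastAtMost finite_subset partition_onD1)
    then have "card (connected_pairs {1..card V}) = card (connected_pairs V)" if "V \<in> \<sigma>" for V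
      using that by (intro card_connected_pairs_cong) auto
    then show ?thesis by (simp only: card_pairs_connecting_blocks[OF \<sigma>] cong: prod.cong)
  qed
  then have "(\<Sum>\<sigma>\<in>NC N. \<Prod>V\<in>\<sigma>. card (connected_pairs {1..card V})) = (\<Sum>\<sigma>\<in>NC N. card (?X \<sigma>))"
    by simp
  also have "\<dots> = card (\<Union>\<sigma>\<in>NC N. ?X \<sigma>)"
  proof (rule card_UN_disjoint[symmetric, OF finite_NC])
    have "finite (nc_pairings {1..N} \<times> nc_pairings {1..N})" by (simp add: finite_nc_pairings)
    then show "\<forall>\<sigma>\<in>NC N. finite (?X \<sigma>)"
      by (auto elim: finite_subset[rotated])
    have "\<sigma> \<subseteq> \<tau>" if "\<sigma> \<in> NC N" "\<tau> \<in> NC N" "q \<in> ?X \<sigma>" "q \<in> ?X \<tau>" for \<sigma> \<tau> q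
    proof -
      from that(3,4) have "\<forall>V\<in>\<sigma>. connects (fst q) (snd q) V" "\<forall>V\<in>\<tau>. connects (fst q) (snd q) V"
        by (simp_all add: case_prod_beta)
      then show ?thesis
        by (rule connects_partition_unique[OF NC_partition[OF that(1)] NC_partition[OF that(2)]])
    qed
    then have "\<sigma> = \<tau>" if "\<sigma> \<in> NC N" "\<tau> \<in> NC N" "q \<in> ?X \<sigma>" "q \<in> ?X \<tau>" for \<sigma> \<tau> q
      using that by (intro subset_antisym)
    then show "\<forall>\<sigma>\<in>NC N. \<forall>\<tau>\<in>NC N. \<sigma> \<noteq> \<tau> \<longrightarrow> ?X \<sigma> \<inter> ?X \<tau> = {}" by blast
  qed
  also have "(\<Union>\<sigma>\<in>NC N. ?X \<sigma>) = ?Y" by blast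
  finally show ?thesis .
qed

section \<open>Meandric systems as pairs of non-crossing pairings\<close>

lemma finite_block: "partition_on {1..n} \<pi> \<Longrightarrow> V \<in> \<pi> \<Longrightarrow> finite V" for n :: nat
  by (metis Union_upper finite_atLeastAtMost finite_subset partition_onD1)

text \<open>Below the maximum of its block a point moves to the next one, and the maximum returns to
  the minimum. The second case has \<open>\<le>\<close> because the point of a singleton block is
  fixed.\<close>

lemma block_perm_block:
  assumes p: "partition_on {1..n} \<pi>" and V: "V \<in> \<pi>" "i \<in> V"
  shows "block_perm \<pi> i \<in> V"
    and "i < block_perm \<pi> i \<Longrightarrow> V \<inter> {i<..<block_perm \<pi> i} = {}"
    and "block_perm \<pi> i \<le> i \<Longrightarrow> V \<subseteq> {block_perm \<pi> i..i}"
proof -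
  have fin: "finite V" using finite_block[OF p V(1)] .
  have eq: "block_perm \<pi> i = (if \<exists>j\<in>V. i < j then Min {j \<in> V. i < j} else Min V)"
    using V block_of_eq[OF p V] by (auto simp: block_perm_def)
  have "block_perm \<pi> i \<in> V \<and> (i < block_perm \<pi> i \<longrightarrow> V \<inter> {i<..<block_perm \<pi> i} = {}) \<and>
      (block_perm \<pi> i \<le> i \<longrightarrow> V \<subseteq> {block_perm \<pi> i..i})"
  proof (cases "\<exists>j\<in>V. i < j")
    case True
    then have e: "block_perm \<pi> i = Min {j \<in> V. i < j}" by (simp add: eq)
    have fin': "finite {j \<in> V. i < j}" using fin by simp
    have "Min {j \<in> V. i < j} \<in> {j \<in> V. i < j}" using True fin' by (intro Min_in) auto
    moreover have "Min {j \<in> V. i < j} \<le> x" if "x \<in> V" "i < x" for x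
      using fin' that by (intro Min_le) auto
    ultimately show ?thesis unfolding e by fastforce
  next
    case False
    then have e: "block_perm \<pi> i = Min V" unfolding eq by (rule if_not_P)
    have "Min V \<in> V" "\<And>x. x \<in> V \<Longrightarrow> Min V \<le> x" using fin V by (auto intro: Min_in)
    then show ?thesis unfolding e using False by (auto simp: not_less)
  qed
  then show "block_perm \<pi> i \<in> V"
    and "i < block_perm \<pi> i \<Longrightarrow> V \<inter> {i<..<block_perm \<pi> i} = {}"
    and "block_perm \<pi> i \<le> i \<Longrightarrow> V \<subseteq> {block_perm \<pi> i..i}" by blast+
qed

text \<open>Converse to \<open>block_perm_block\<close>: the empty gap and the span determine the
  successor of \<open>i\<close>. It serves to recognise a permutation read off from a pairing as the
  increasing cycle on its orbits.\<close>

lemma block_perm_eqI: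
  assumes p: "partition_on {1..n} \<pi>" and V: "V \<in> \<pi>" "i \<in> V" and j: "j \<in> V"
    and gap: "i < j \<Longrightarrow> V \<inter> {i<..<j} = {}" and span: "j \<le> i \<Longrightarrow> V \<subseteq> {j..i}"
  shows "block_perm \<pi> i = j"
proof -
  note B = block_perm_block[OF p V]
  consider "i < j" "i < block_perm \<pi> i" | "i < j" "block_perm \<pi> i \<le> i" | "j \<le> i" by linarith
  then show ?thesis
  proof cases
    case 1
    then have "j \<notin> {i<..<block_perm \<pi> i}" "block_perm \<pi> i \<notin> {i<..<j}"
      using B(1,2) gap j by blast+
    then show ?thesis using 1 by auto
  next
    case 2
    then have "j \<in> {block_perm \<pi> i..i}" using B(3) j by blast
    then show ?thesis using 2 by simp
  next
    case 3
    then have "block_perm \<pi> i \<in> {j..i}" using span B(1) by blast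
    moreover from this have "j \<in> {block_perm \<pi> i..i}" using B(3) j by auto
    ultimately show ?thesis by simp
  qed
qed

lemma orbit_subset_closed:
  assumes "x \<in> U" "\<And>y. y \<in> U \<Longrightarrow> f y \<in> U"
  shows "orbit f x \<subseteq> U"
proof
  fix y assume "y \<in> orbit f x"
  then show "y \<in> U" by induction (use assms in auto)
qed

text \<open>An orbit missing a point \<open>j\<close> of the block would have a largest element
  below \<open>j\<close>. Its successor in the block is at most \<open>j\<close>, differs from
  \<open>j\<close>, and stays in the orbit, which contradicts the choice.\<close>

lemma orbit_block_perm:
  assumes p: "partition_on {1..n} \<pi>" and V: "V \<in> \<pi>" "i \<in> V"
  shows "orbit (block_perm \<pi>) i = V"
proof -
  let ?P = "block_perm \<pi>"
  note B = block_perm_block[OF p V(1)]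
  define U where "U = orbit ?P i"
  have UV: "U \<subseteq> V" unfolding U_def using V B(1) by (intro orbit_subset_closed)
  have cl: "?P u \<in> U" if "u \<in> U" for u using that by (auto simp: U_def intro: orbit.step)
  have ne: "U \<noteq> {}" by (auto simp: U_def orbit_nonempty)
  have fin: "finite U" using UV finite_block[OF p V(1)] by (rule finite_subset)
  have "j \<in> U" if j: "j \<in> V" for j
  proof (rule ccontr)
    assume jU: "j \<notin> U"
    \<comment> \<open>The orbit does have points below \<open>j\<close>: its maximum cannot move up
      inside the orbit, so it is mapped to the minimum of \<open>V\<close>.\<close>
    define m where "m = Max U"
    have m: "m \<in> U" using fin ne by (simp add: m_def)
    have "?P m \<le> m" using cl[OF m] fin by (simp add: m_def)
    then have "V \<subseteq> {?P m..m}" using B(3) m UV by blast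
    then have "?P m \<le> j" using j by auto
    then have "?P m \<in> {u \<in> U. u < j}" using jU cl[OF m] by (cases "?P m = j") auto
    then have "{u \<in> U. u < j} \<noteq> {}" by blast
    moreover define u where "u = Max {u \<in> U. u < j}"
    ultimately have "u \<in> {u \<in> U. u < j}" using fin unfolding u_def by (intro Max_in) auto
    then have u: "u \<in> U" "u < j" by auto
    have uV: "u \<in> V" using u UV by blast
    have "u < ?P u"
    proof (rule ccontr)
      assume "\<not> u < ?P u"
      then have "V \<subseteq> {?P u..u}" using B(3)[OF uV] by simp
      then show False using j u(2) by auto
    qed
    then have "j \<notin> {u<..<?P u}" using B(2)[OF uV] j by blast
    moreover have "?P u \<noteq> j" using cl[OF u(1)] jU by auto
    ultimately have "?P u \<in> {u \<in> U. u < j}" using cl[OF u(1)] u(2) by auto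
    then have "?P u \<le> u" using fin by (auto simp: u_def)
    then show False using \<open>u < ?P u\<close> by simp
  qed
  then show ?thesis using UV by (auto simp: U_def)
qed

text \<open>Recovers the partition from its permutation, which makes \<open>fattening\<close>
  injective.\<close>

lemma partition_eq_orbits:
  assumes p: "partition_on {1..n} \<pi>"
  shows "\<pi> = orbit (block_perm \<pi>) ` {1..n}"
proof (intro equalityI subsetI)
  fix V assume V: "V \<in> \<pi>"
  then obtain i where i: "i \<in> V" using p by (force simp: partition_on_def)
  then have "i \<in> {1..n}" using V p by (auto simp: partition_on_def)
  then show "V \<in> orbit (block_perm \<pi>) ` {1..n}" using orbit_block_perm[OF p V i] by blast
next
  fix V assume "V \<in> orbit (block_perm \<pi>) ` {1..n}"
  then obtain i where i: "i \<in> {1..n}" "V = orbit (block_perm \<pi>) i" by blast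
  then obtain W where "W \<in> \<pi>" "i \<in> W" using partition_onD1[OF p] by blast
  then show "V \<in> \<pi>" using orbit_block_perm[OF p] i by simp
qed

text \<open>\<open>orbit P x\<close> starts at \<open>P x\<close>; that it contains \<open>x\<close>
  itself comes from \<open>P\<close> being a permutation of a finite set.\<close>

lemma partition_on_orbits:
  assumes P: "P permutes S" and fin: "finite S"
  shows "partition_on S (orbit P ` S)"
proof (rule partition_onI)
  have perm: "permutation P" using P fin by (auto simp: permutation_permutes)
  show "\<Union> (orbit P ` S) = S"
    using permutes_orbit_subset[OF P] permutation_self_in_orbit[OF perm] by blast
  show "{} \<notin> orbit P ` S" using orbit_nonempty[of P] by (metis imageE)
  show "disjnt V W" if VW: "V \<in> orbit P ` S" "W \<in> orbit P ` S" "V \<noteq> W" for V W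
  proof (rule ccontr)
    assume "\<not> disjnt V W"
    then obtain z where "z \<in> V" "z \<in> W" by (auto simp: disjnt_def)
    moreover have "cyclic_on P V" "cyclic_on P W" using VW cyclic_on_orbit[OF P fin] by auto
    ultimately show False using orbit_cyclic_eq3 VW(3) by metis
  qed
qed

section \<open>The bijection between non-crossing partitions and pairings\<close>

text \<open>The arcs of \<open>fattening n \<pi>\<close> are the \<open>{2i, 2P i - 1}\<close> with \<open>P = block_perm \<pi>\<close>.\<close>

abbreviation fattening :: "nat \<Rightarrow> nat set set \<Rightarrow> nat \<Rightarrow> nat" where
  "fattening n \<pi> \<equiv> meandric_system n \<pi> \<pi>"

text \<open>Reduces meandric systems to the two separate pairings.\<close>

lemma meandric_system_if:
  "meandric_system n \<pi> \<rho> k = (if odd k then fattening n \<pi> k else fattening n \<rho> k)"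
  by (simp add: meandric_system_def)

lemma meandric_system_even:
  "i \<in> {1..n} \<Longrightarrow> meandric_system n \<pi> \<rho> (2 * i) = 2 * block_perm \<rho> i - 1"
  by (simp add: meandric_system_def)

text \<open>Writing the odd points as \<open>2 * block_perm \<pi> i - 1\<close> removes the inverse
  permutation from later arguments.\<close>

lemma meandric_system_odd:
  assumes p: "partition_on {1..n} \<pi>" and i: "i \<in> {1..n}"
  shows "meandric_system n \<pi> \<rho> (2 * block_perm \<pi> i - 1) = 2 * i"
proof -
  have P: "block_perm \<pi> permutes {1..n}" using block_perm_permutes[OF p] .
  have "block_perm \<pi> i \<in> {1..n}" using i by (simp only: permutes_in_image[OF P])
  then have "2 * block_perm \<pi> i - 1 \<in> {1..2 * n}" "odd (2 * block_perm \<pi> i - 1)"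
    "(2 * block_perm \<pi> i - 1 + 1) div 2 = block_perm \<pi> i" by auto
  then show ?thesis unfolding meandric_system_def using permutes_inverses(2)[OF P] by simp
qed

text \<open>Presents a point as the even or the odd end of its arc, so that crossings of arcs become
  inequalities between indices and their images under \<open>block_perm \<pi>\<close>.\<close>

lemma fattening_cases:
  assumes p: "partition_on {1..n} \<pi>" and x: "x \<in> {1..2 * n}"
  obtains i where "i \<in> {1..n}" "block_perm \<pi> i \<in> {1..n}" "x = 2 * i" "fattening n \<pi> x = 2 * block_perm \<pi> i - 1"
  | i where "i \<in> {1..n}" "block_perm \<pi> i \<in> {1..n}" "x = 2 * block_perm \<pi> i - 1" "fattening n \<pi> x = 2 * i"
proof (cases "even x")
  have P: "block_perm \<pi> permutes {1..n}" using block_perm_permutes[OF p] .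
  case True
  then obtain i where i: "x = 2 * i" by blast
  then have "i \<in> {1..n}" using x by auto
  then show ?thesis using that(1)[of i] i permutes_in_image[OF P] meandric_system_even by simp
next
  have P: "block_perm \<pi> permutes {1..n}" using block_perm_permutes[OF p] .
  case False
  define j where "j = (x + 1) div 2"
  have j: "j \<in> {1..n}" "x = 2 * j - 1" using x False by (auto simp: j_def elim!: oddE)
  then obtain i where i: "i \<in> {1..n}" "j = block_perm \<pi> i"
    using permutes_image[OF P] by (metis imageE)
  then show ?thesis using that(2)[of i] j meandric_system_odd[OF p i(1)] by simp
qed

lemma fattening_nc_pairings:
  assumes \<pi>: "\<pi> \<in> NC n"
  shows "fattening n \<pi> \<in> nc_pairings {1..2 * n}"
proof (rule nc_pairingsI)
  note p = NC_partition[OF \<pi>]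
  let ?P = "block_perm \<pi>"
  {
    fix x assume x: "x \<in> {1..2 * n}"
    show "fattening n \<pi> x \<in> {1..2 * n}"
      using p x by (cases rule: fattening_cases) auto
    show "fattening n \<pi> x \<noteq> x"
      using p x by (cases rule: fattening_cases) (auto, presburger+)
    show "fattening n \<pi> (fattening n \<pi> x) = x"
      using p x by (cases rule: fattening_cases)
        (simp_all only: meandric_system_even meandric_system_odd[OF p])
  }
  show "fattening n \<pi> x = x" if "x \<notin> {1..2 * n}" for x
    using that unfolding meandric_system_def by (rule if_not_P)
  fix a b assume a: "a \<in> {1..2 * n}" and b: "b \<in> {1..2 * n}"
    and ab: "a < b" "b < fattening n \<pi> a" "fattening n \<pi> a < fattening n \<pi> b"
  have block: "\<exists>V. V \<in> \<pi> \<and> i \<in> V \<and> ?P i \<in> V" if "i \<in> {1..n}" for i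
    using that partition_onD1[OF p] block_perm_block(1)[OF p] by blast
  \<comment> \<open>Common end of the four cases: non-crossing forces both arcs into one block, and
    there an end of the second arc would lie in a gap of the block or outside its span.\<close>
  have same: False if arcs: "i \<in> {1..n}" "j \<in> {1..n}" and cr: "\<And>V W. V \<in> \<pi> \<Longrightarrow> W \<in> \<pi> \<Longrightarrow>
      i \<in> V \<Longrightarrow> ?P i \<in> V \<Longrightarrow> j \<in> W \<Longrightarrow> ?P j \<in> W \<Longrightarrow> V = W"
    and out: "i < ?P i \<Longrightarrow> j \<in> {i<..<?P i} \<or> ?P j \<in> {i<..<?P i}"
      "?P i \<le> i \<Longrightarrow> \<not> {j, ?P j} \<subseteq> {?P i..i}" for i j
  proof -
    obtain V W where V: "V \<in> \<pi>" "i \<in> V" "?P i \<in> V" and W: "W \<in> \<pi>" "j \<in> W" "?P j \<in> W"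
      using block arcs by meson
    have "V = W" using cr V W by blast
    then show False using block_perm_block(2,3)[OF p V(1,2)] out W by (cases "i < ?P i") auto
  qed
  show False
    using p a
  proof (cases rule: fattening_cases)
    case i: (1 i)
    show False using p b
    proof (cases rule: fattening_cases)
      case j: (1 j)
      have o: "i < j" "j < ?P i" "?P i < ?P j" using ab i j by auto
      show False by (rule same[OF i(1) j(1)]) (use o NC_crossing[OF \<pi> _ _ o] in auto)
    next
      case j: (2 j)
      \<comment> \<open>Comparing an odd point with a larger even one gives only
        \<open>\<le>\<close> after halving. In the case of equality the two blocks share a point, so
        they coincide without an appeal to crossings.\<close>
      have o: "i < ?P j" "?P j < ?P i" "?P i \<le> j" using ab i j by auto
      have "V = W" if "V \<in> \<pi>" "W \<in> \<pi>" "i \<in> V" "?P i \<in> V" "j \<in> W" "?P j \<in> W" for V W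
      proof (cases "?P i = j")
        case True
        then show ?thesis using block_of_eq[OF p] that by metis
      qed (use o that NC_crossing[OF \<pi> that(1,2) o(1,2), of j] in auto)
      then show False using o by (intro same[OF i(1) j(1)]) auto
    qed
  next
    case i: (2 i)
    show False using p b
    proof (cases rule: fattening_cases)
      case j: (1 j)
      have o: "?P i \<le> j" "j < i" "i < ?P j" using ab i j by auto
      have "V = W" if "V \<in> \<pi>" "W \<in> \<pi>" "i \<in> V" "?P i \<in> V" "j \<in> W" "?P j \<in> W" for V W
      proof (cases "?P i = j")
        case True
        then show ?thesis using block_of_eq[OF p] that by metis
      qed (use o that NC_crossing[OF \<pi> that(1,2) _ o(2,3), of "?P i"] in auto)
      then show False using o by (intro same[OF i(1) j(1)]) auto
    next
      case j: (2 j)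
      have o: "?P i < ?P j" "?P j \<le> i" "i < j" using ab i j by auto
      have "V = W" if "V \<in> \<pi>" "W \<in> \<pi>" "i \<in> V" "?P i \<in> V" "j \<in> W" "?P j \<in> W" for V W
      proof (cases "?P j = i")
        case True
        then show ?thesis using block_of_eq[OF p] that by metis
      qed (use o that NC_crossing[OF \<pi> that(1,2) o(1) _ o(3)] in auto)
      then show False using o by (intro same[OF i(1) j(1)]) auto
    qed
  qed
qed

lemma inj_on_fattening: "inj_on (fattening n) (NC n)"
proof (rule inj_onI)
  fix \<pi> \<rho> assume \<pi>: "\<pi> \<in> NC n" and \<rho>: "\<rho> \<in> NC n" and eq: "fattening n \<pi> = fattening n \<rho>"
  note P = block_perm_permutes[OF NC_partition[OF \<pi>]] and R = block_perm_permutes[OF NC_partition[OF \<rho>]]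
  have "block_perm \<pi> i = block_perm \<rho> i" for i
  proof (cases "i \<in> {1..n}")
    case True
    then have "block_perm \<pi> i \<in> {1..n}" "block_perm \<rho> i \<in> {1..n}"
      using permutes_in_image[OF P] permutes_in_image[OF R] by blast+
    moreover have "2 * block_perm \<pi> i - 1 = 2 * block_perm \<rho> i - 1"
      using meandric_system_even[OF True] eq by metis
    ultimately show ?thesis by auto
  qed (simp add: permutes_not_in[OF P] permutes_not_in[OF R])
  then have "block_perm \<pi> = block_perm \<rho>" ..
  then show "\<pi> = \<rho>"
    using partition_eq_orbits[OF NC_partition[OF \<pi>]] partition_eq_orbits[OF NC_partition[OF \<rho>]] by simp
qed

text \<open>The arcs at the even points define a permutation \<open>P\<close>, and the wanted
  partition consists of its orbits. Since arcs are nested or disjoint, orbits cannot leave the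
  region under an arc; this shows both that the orbits do not cross and that \<open>P\<close> is the
  increasing cycle on each of them.\<close>

lemma fattening_surj:
  assumes f: "f \<in> nc_pairings {1..2 * n}"
  shows "\<exists>\<pi>\<in>NC n. fattening n \<pi> = f"
proof -
  note D = nc_pairingsD[OF f]
  \<comment> \<open>Solves \<open>f (2 * i) = 2 * P i - 1\<close>, which is possible because
    \<open>f (2 * i)\<close> is odd by \<open>nc_pairings_parity\<close>.\<close>
  define P where "P i = (if i \<in> {1..n} then (f (2 * i) + 1) div 2 else i)" for i
  define \<pi> where "\<pi> = orbit P ` {1..n}"
  have fP: "f (2 * i) = 2 * P i - 1" "f (2 * P i - 1) = 2 * i" "P i \<in> {1..n}" if i: "i \<in> {1..n}" for i
  proof -
    have i2: "2 * i \<in> {1..2 * n}" using i by auto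
    have "odd (f (2 * i))" using nc_pairings_parity[OF f i2] by simp
    then obtain k where k: "f (2 * i) = 2 * k + 1" by (rule oddE)
    then have Pi: "P i = k + 1" using i unfolding P_def by simp
    show f2: "f (2 * i) = 2 * P i - 1" by (simp add: Pi k)
    show "P i \<in> {1..n}" using D(1)[OF i2] by (simp add: Pi k)
    show "f (2 * P i - 1) = 2 * i" using D(3)[of "2 * i"] by (simp only: f2)
  qed
  have inj: "inj_on P {1..n}"
  proof (rule inj_onI)
    fix i j assume "i \<in> {1..n}" "j \<in> {1..n}" "P i = P j"
    then show "i = j" using fP(2)[of i] fP(2)[of j] by simp
  qed
  have P: "P permutes {1..n}"
  proof (rule bij_imp_permutes)
    have "P ` {1..n} = {1..n}" using fP(3) inj by (intro endo_inj_surj) auto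
    then show "bij_betw P {1..n} {1..n}" using inj by (simp add: bij_betw_def)
    show "P i = i" if "i \<notin> {1..n}" for i using that unfolding P_def by (rule if_not_P)
  qed
  have perm: "permutation P" using P by (auto simp: permutation_permutes)
  have p: "partition_on {1..n} \<pi>" unfolding \<pi>_def using P by (intro partition_on_orbits) auto
  have orb: "orbit P i = V" "i \<in> {1..n}" if "V \<in> \<pi>" "i \<in> V" for V i
  proof -
    show "orbit P i = V"
      using that cyclic_on_orbit[OF P] by (intro orbit_cyclic_eq3) (auto simp: \<pi>_def)
    show "i \<in> {1..n}" using that p by (auto simp: partition_on_def)
  qed
  have in_V: "P i \<in> V" if "V \<in> \<pi>" "i \<in> V" for V i
    using orb(1)[OF that] orbit.base[of P i] by simp
  \<comment> \<open>The arc from \<open>2 * i\<close> up to \<open>2 * P i - 1\<close> covers the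
    even points \<open>2 * j\<close> with \<open>i < j < P i\<close>, so \<open>P\<close> maps this
    open interval into itself.\<close>
  have gap: "orbit P b \<subseteq> {i<..<P i}" if i: "i \<in> {1..n}" "b \<in> {i<..<P i}" for i b
  proof (rule orbit_subset_closed[OF i(2)])
    fix j assume j: "j \<in> {i<..<P i}"
    then have j': "j \<in> {1..n}" using i fP(3)[OF i(1)] by auto
    have "2 * i \<in> {1..2 * n}" "2 * j \<in> {1..2 * n}" "2 * i < 2 * j" "2 * j < f (2 * i)"
      unfolding fP(1)[OF i(1)] using i j j' by auto
    note nc_pairings_between[OF f this]
    then show "P j \<in> {i<..<P i}" using fP[OF i(1)] fP[OF j'] by auto
  qed
  \<comment> \<open>The arc from \<open>2 * P i - 1\<close> up to \<open>2 * i\<close> encloses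
    \<open>2 * j\<close> for \<open>P i \<le> j < i\<close>; the right end \<open>j = i\<close> is
    sent to the left end.\<close>
  have span: "orbit P i \<subseteq> {P i..i}" if i: "i \<in> {1..n}" "P i \<le> i" for i
  proof (rule orbit_subset_closed)
    show "i \<in> {P i..i}" using i by simp
    fix j assume j: "j \<in> {P i..i}"
    then have j': "j \<in> {1..n}" using i fP(3)[OF i(1)] by auto
    show "P j \<in> {P i..i}"
    proof (cases "j = i")
      case False
      have "2 * P i - 1 \<in> {1..2 * n}" "2 * j \<in> {1..2 * n}" "2 * P i - 1 < 2 * j" "2 * j < f (2 * P i - 1)"
        unfolding fP(2)[OF i(1)] using i j j' False fP(3)[OF i(1)] by auto
      note nc_pairings_between[OF f this]
      then show ?thesis using fP[OF i(1)] fP[OF j'] by auto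
    qed (use i in simp)
  qed
  have gap_V: "V \<inter> {i<..<P i} = {}" if V: "V \<in> \<pi>" "i \<in> V" for V i
  proof (rule equals0I)
    fix b assume b: "b \<in> V \<inter> {i<..<P i}"
    then have "V \<subseteq> {i<..<P i}" using gap[OF orb(2)[OF V], of b] orb(1)[OF V(1), of b] by simp
    then show False using V(2) by auto
  qed
  have cross: False if V: "V \<in> \<pi>" "W \<in> \<pi>" "V \<noteq> W" and o: "a < b" "b < c" "c < d"
      and m: "a \<in> V" "c \<in> V" "b \<in> W" "d \<in> W" for V W a b c d
  proof -
    \<comment> \<open>The last point of \<open>V\<close> before \<open>b\<close>. Its image jumps
      over \<open>b\<close>, so the whole orbit \<open>W\<close> is trapped in the gap up to
      \<open>P i\<close>, whereas \<open>c\<close> and hence \<open>d\<close> lie at or beyond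
      \<open>P i\<close>.\<close>
    define i where "i = Max {x \<in> V. x < b}"
    have fin: "finite {x \<in> V. x < b}" by simp
    have "i \<in> {x \<in> V. x < b}" unfolding i_def using m(1) o(1) by (intro Max_in[OF fin]) auto
    then have i: "i \<in> V" "i < b" by auto
    have Pi: "P i \<in> V" using in_V[OF V(1) i(1)] .
    have "i < P i"
    proof (rule ccontr)
      assume "\<not> i < P i"
      then have "V \<subseteq> {P i..i}" using span[OF orb(2)[OF V(1) i(1)]] orb(1)[OF V(1) i(1)] by simp
      then show False using m(2) o i by auto
    qed
    have "b \<notin> V" using orb(1)[OF V(1)] orb(1)[OF V(2) m(3)] V(3) by blast
    have "\<not> P i < b"
    proof
      assume "P i < b"
      then have "P i \<le> i" unfolding i_def using Pi by (intro Max_ge[OF fin]) (simp add: i_def)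
      then show False using \<open>i < P i\<close> by simp
    qed
    then have "b \<in> {i<..<P i}" using \<open>b \<notin> V\<close> Pi i(2) by (cases "P i = b") auto
    then have "W \<subseteq> {i<..<P i}" using gap[OF orb(2)[OF V(1) i(1)], of b] orb(1)[OF V(2) m(3)] by blast
    moreover have "c \<notin> {i<..<P i}" using gap_V[OF V(1) i(1)] m(2) by blast
    ultimately show False using m(4) o i(2) by auto
  qed
  have \<pi>NC: "\<pi> \<in> NC n"
    unfolding NC_def mem_Collect_eq
    by (rule conjI[OF p], rule notI, elim bexE exE conjE, rule cross)
  have eq: "block_perm \<pi> i = P i" if i: "i \<in> {1..n}" for i
  proof -
    obtain V where V: "V \<in> \<pi>" "i \<in> V" using i partition_onD1[OF p] by blast
    show ?thesis
      by (rule block_perm_eqI[OF p V in_V[OF V] gap_V[OF V]]) (use span[OF i] orb[OF V] in simp)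
  qed
  have "fattening n \<pi> x = f x" for x
  proof (cases "x \<in> {1..2 * n}")
    case True
    show ?thesis using p True by (cases rule: fattening_cases) (simp_all only: eq fP)
  next
    case False
    have "fattening n \<pi> x = x" using False unfolding meandric_system_def by (rule if_not_P)
    then show ?thesis using D(4)[OF False] by simp
  qed
  then show ?thesis using \<pi>NC by blast
qed

section \<open>Orbits of meandric systems\<close>

text \<open>Exchanging \<open>\<pi>\<close> and \<open>\<rho>\<close> gives the inverse: each
  fattening flips parity, so the second step applies the same involution as the first.\<close>

lemma meandric_system_permutes:
  assumes \<pi>: "\<pi> \<in> NC n" and \<rho>: "\<rho> \<in> NC n"
  shows "meandric_system n \<pi> \<rho> permutes {1..2 * n}"
proof -
  have out: "meandric_system n \<pi> \<rho> x = x" if "x \<notin> {1..2 * n}"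
    for \<pi> \<rho> x using that unfolding meandric_system_def by (rule if_not_P)
  have inv: "meandric_system n \<pi> \<rho> (meandric_system n \<rho> \<pi> x) = x" if \<pi>: "\<pi> \<in> NC n" and \<rho>: "\<rho> \<in> NC n" for \<pi> \<rho> x
  proof (cases "x \<in> {1..2 * n}")
    case True
    note N = fattening_nc_pairings[OF \<pi>] fattening_nc_pairings[OF \<rho>]
    show ?thesis
      by (simp add: meandric_system_if[of n \<pi> \<rho>] meandric_system_if[of n \<rho> \<pi>]
          nc_pairings_parity[OF N(1) True] nc_pairings_parity[OF N(2) True]
          nc_pairingsD(3)[OF N(1)] nc_pairingsD(3)[OF N(2)])
  next
    case False
    then show ?thesis using out by metis
  qed
  show ?thesis
    unfolding permutes_def using out inv[OF \<pi> \<rho>] inv[OF \<rho> \<pi>] by metis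
qed

lemma meandric_orbits_partition:
  assumes "\<pi> \<in> NC n" "\<rho> \<in> NC n"
  shows "partition_on {1..2 * n} (meandric_orbits n \<pi> \<rho>)"
  unfolding meandric_orbits_def
  by (rule partition_on_orbits[OF meandric_system_permutes[OF assms] finite_atLeastAtMost])

text \<open>At every point of \<open>{1..2 * n}\<close> one of the two fattenings is the meandric
  system and the other is its inverse, so orbits are closed under both. Conversely, a set closed
  under both is closed under the system, which gives minimality.\<close>

lemma connects_meandric_orbits:
  assumes \<pi>: "\<pi> \<in> NC n" and \<rho>: "\<rho> \<in> NC n" and V: "V \<in> meandric_orbits n \<pi> \<rho>"
  shows "connects (fattening n \<pi>) (fattening n \<rho>) V"
proof -
  let ?M = "meandric_system n \<pi> \<rho>"
  note N = fattening_nc_pairings[OF \<pi>] fattening_nc_pairings[OF \<rho>]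
  have M: "?M permutes {1..2 * n}" using meandric_system_permutes[OF \<pi> \<rho>] .
  have cyc: "cyclic_on ?M V"
    using V cyclic_on_orbit[OF M] by (auto simp: meandric_orbits_def)
  have sub: "V \<subseteq> {1..2 * n}" using meandric_orbits_partition[OF \<pi> \<rho>] V by (auto simp: partition_on_def)
  have cl: "fattening n \<pi> x \<in> V" "fattening n \<rho> x \<in> V" if x: "x \<in> V" for x
  proof -
    have xS: "x \<in> {1..2 * n}" using x sub by blast
    note par = nc_pairings_parity[OF N(1) xS] nc_pairings_parity[OF N(2) xS]
    have "?M x \<in> V" using cyclic_on_inI[OF cyc x] .
    moreover have "y \<in> V" if "?M y = x" for y
      using cyclic_on_f_in[OF M cyc, of y] that x by simp
    ultimately show "fattening n \<pi> x \<in> V" "fattening n \<rho> x \<in> V"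
      by (cases "odd x"; simp add: meandric_system_if[of n \<pi> \<rho>] par nc_pairingsD(3)[OF N(1)] nc_pairingsD(3)[OF N(2)])+
  qed
  show ?thesis
    unfolding connects_def
  proof (intro conjI allI impI)
    show "V \<noteq> {}" using cyc by (auto simp: cyclic_on_alldef)
    show "fattening n \<pi> ` V \<subseteq> V" "fattening n \<rho> ` V \<subseteq> V" using cl by auto
    fix U assume U: "U \<subseteq> V" "U \<noteq> {}" "fattening n \<pi> ` U \<subseteq> U" "fattening n \<rho> ` U \<subseteq> U"
    then obtain u where u: "u \<in> U" by blast
    have "orbit ?M u \<subseteq> U"
      using u U(3,4) by (intro orbit_subset_closed) (auto simp: meandric_system_if[of n \<pi> \<rho>])
    moreover have "orbit ?M u = V" using orbit_cyclic_eq3[OF cyc] u U(1) by blast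
    ultimately show "U = V" using U(1) by blast
  qed
qed

text \<open>If the whole set is connected, it and the orbits are two partitions into connected
  blocks, hence equal. The one-block partition requires \<open>n \<ge> 1\<close>, as blocks are
  non-empty.\<close>

lemma is_meander_iff_connects:
  assumes \<pi>: "\<pi> \<in> NC n" and \<rho>: "\<rho> \<in> NC n" and n: "n \<ge> 1"
  shows "is_meander n \<pi> \<rho> \<longleftrightarrow> connects (fattening n \<pi>) (fattening n \<rho>) {1..2 * n}"
proof
  note p = meandric_orbits_partition[OF \<pi> \<rho>]
  assume "is_meander n \<pi> \<rho>"
  then obtain V where V: "meandric_orbits n \<pi> \<rho> = {V}"
    by (auto simp: is_meander_def card_1_singleton_iff)
  then have "V = {1..2 * n}" using partition_onD1[OF p] by simp
  then show "connects (fattening n \<pi>) (fattening n \<rho>) {1..2 * n}"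
    using connects_meandric_orbits[OF \<pi> \<rho>] V by blast
next
  note p = meandric_orbits_partition[OF \<pi> \<rho>]
  assume con: "connects (fattening n \<pi>) (fattening n \<rho>) {1..2 * n}"
  have q: "partition_on {1..2 * n} {{1..2 * n}}" using n by (intro partition_on_space) auto
  have con1: "\<forall>V\<in>{{1..2 * n}}. connects (fattening n \<pi>) (fattening n \<rho>) V" using con by simp
  have con2: "\<forall>V\<in>meandric_orbits n \<pi> \<rho>. connects (fattening n \<pi>) (fattening n \<rho>) V"
    using connects_meandric_orbits[OF \<pi> \<rho>] by (rule ballI)
  have "meandric_orbits n \<pi> \<rho> = {{1..2 * n}}"
    by (rule equalityI[OF connects_partition_unique[OF p q con2 con1] connects_partition_unique[OF q p con1 con2]])
  then show "is_meander n \<pi> \<rho>" by (simp add: is_meander_def)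
qed

text \<open>By uniqueness, the orbit partition is the only candidate for
  \<open>\<sigma>\<close>.\<close>

lemma strictly_noncrossing_iff:
  assumes \<pi>: "\<pi> \<in> NC n" and \<rho>: "\<rho> \<in> NC n"
  shows "strictly_noncrossing n \<pi> \<rho> \<longleftrightarrow>
    (\<exists>\<sigma>\<in>NC (2 * n). \<forall>V\<in>\<sigma>. connects (fattening n \<pi>) (fattening n \<rho>) V)"
proof
  assume "strictly_noncrossing n \<pi> \<rho>"
  then have "meandric_orbits n \<pi> \<rho> \<in> NC (2 * n)" by (simp only: strictly_noncrossing_def)
  then show "\<exists>\<sigma>\<in>NC (2 * n). \<forall>V\<in>\<sigma>. connects (fattening n \<pi>) (fattening n \<rho>) V"
    by (rule bexI[rotated]) (rule ballI[OF connects_meandric_orbits[OF \<pi> \<rho>]])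
next
  assume "\<exists>\<sigma>\<in>NC (2 * n). \<forall>V\<in>\<sigma>. connects (fattening n \<pi>) (fattening n \<rho>) V"
  then obtain \<sigma> where \<sigma>: "\<sigma> \<in> NC (2 * n)" "\<forall>V\<in>\<sigma>. connects (fattening n \<pi>) (fattening n \<rho>) V" by blast
  note p = NC_partition[OF \<sigma>(1)] and q = meandric_orbits_partition[OF \<pi> \<rho>]
  have con: "\<forall>V\<in>meandric_orbits n \<pi> \<rho>. connects (fattening n \<pi>) (fattening n \<rho>) V"
    using connects_meandric_orbits[OF \<pi> \<rho>] by (rule ballI)
  have "\<sigma> = meandric_orbits n \<pi> \<rho>"
    by (rule equalityI[OF connects_partition_unique[OF p q \<sigma>(2) con] connects_partition_unique[OF q p con \<sigma>(2)]])
  then show "strictly_noncrossing n \<pi> \<rho>" using \<sigma>(1) by (simp add: strictly_noncrossing_def)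
qed

section \<open>Counting and the moment-cumulant formula\<close>

text \<open>The properties \<open>Q\<close> and \<open>R\<close> are kept abstract so that one
  bijection serves both meanders and strictly non-crossing systems.\<close>

lemma card_fattening_pairs:
  assumes "\<And>\<pi> \<rho>. \<pi> \<in> NC n \<Longrightarrow> \<rho> \<in> NC n \<Longrightarrow> Q \<pi> \<rho> \<longleftrightarrow> R (fattening n \<pi>) (fattening n \<rho>)"
  shows "card {(\<pi>, \<rho>). \<pi> \<in> NC n \<and> \<rho> \<in> NC n \<and> Q \<pi> \<rho>} =
    card {(f, g). f \<in> nc_pairings {1..2 * n} \<and> g \<in> nc_pairings {1..2 * n} \<and> R f g}"
    (is "card ?A = card ?B")
proof (rule bij_betw_same_card)
  let ?h = "map_prod (fattening n) (fattening n)"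
  show "bij_betw ?h ?A ?B"
    unfolding bij_betw_def
  proof
    show "inj_on ?h ?A"
      by (rule inj_on_subset[OF map_prod_inj_on[OF inj_on_fattening inj_on_fattening]]) auto
    show "?h ` ?A = ?B"
    proof (intro equalityI subsetI)
      fix q assume "q \<in> ?B"
      then obtain f g where q: "q = (f, g)" "f \<in> nc_pairings {1..2 * n}" "g \<in> nc_pairings {1..2 * n}" "R f g"
        by blast
      then obtain \<pi> \<rho> where "\<pi> \<in> NC n" "fattening n \<pi> = f" "\<rho> \<in> NC n" "fattening n \<rho> = g"
        using fattening_surj by meson
      then have "(\<pi>, \<rho>) \<in> ?A" "q = ?h (\<pi>, \<rho>)" using q assms by auto
      then show "q \<in> ?h ` ?A" by (rule rev_image_eqI)
    next
      fix q assume "q \<in> ?h ` ?A"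
      then obtain p where p: "p \<in> ?A" "q = ?h p" by (elim imageE)
      obtain \<pi> \<rho> where \<pi>\<rho>: "p = (\<pi>, \<rho>)" by (rule prod.exhaust)
      then have NC: "\<pi> \<in> NC n" "\<rho> \<in> NC n" "Q \<pi> \<rho>" using p by simp_all
      then have "R (fattening n \<pi>) (fattening n \<rho>)" by (simp only: assms[OF NC(1,2)])
      then show "q \<in> ?B" using p \<pi>\<rho> NC by (simp add: fattening_nc_pairings del: One_nat_def)
    qed
  qed
qed

lemma meander_number_eq:
  "n \<ge> 1 \<Longrightarrow> meander_number n = card (connected_pairs {1..2 * n})"
  unfolding meander_number_def connected_pairs_def
  using is_meander_iff_connects by (intro card_fattening_pairs)

theorem proposition5p3:
  fixes \<nu> :: "complex poly \<Rightarrow> complex"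
  assumes lin: "Vector_Spaces.linear smult (*) \<nu>"
    and unital: "\<nu> 1 = 1"
    and odd_cumulants: "\<And>n. n \<ge> 1 \<Longrightarrow> free_cumulant \<nu> (2 * n - 1) = 0"
    and even_cumulants: "\<And>n. n \<ge> 1 \<Longrightarrow> free_cumulant \<nu> (2 * n) = of_nat (meander_number n)"
  shows "\<forall>n\<ge>1. \<nu> (monom 1 (2 * n - 1)) = 0 \<and>
    \<nu> (monom 1 (2 * n)) =
      of_nat (card {(\<pi>, \<rho>). \<pi> \<in> NC n \<and> \<rho> \<in> NC n \<and> strictly_noncrossing n \<pi> \<rho>})"
proof -
  \<comment> \<open>One formula covers both parities: for odd \<open>k\<close> there are no
    pairings, which matches the vanishing odd cumulants.\<close>
  have cumulant: "free_cumulant \<nu> k = of_nat (card (connected_pairs {1..k}))" if k: "k \<ge> 1" for k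
  proof (cases "even k")
    case True
    then obtain m where "k = 2 * m" by blast
    then show ?thesis using k even_cumulants[of m] meander_number_eq[of m] by simp
  next
    case False
    then have "nc_pairings {1..k} = {}" by (intro nc_pairings_odd) auto
    moreover obtain m where "k = 2 * m + 1" using False by (rule oddE)
    ultimately show ?thesis using odd_cumulants[of "m + 1"] by (simp add: connected_pairs_def)
  qed
  have moment: "\<nu> (monom 1 N) = of_nat (card {(f, g). f \<in> nc_pairings {1..N} \<and> g \<in> nc_pairings {1..N} \<and>
      (\<exists>\<sigma>\<in>NC N. \<forall>V\<in>\<sigma>. connects f g V)})" if "N \<ge> 1" for N
  proof -
    \<comment> \<open>\<open>cumulant\<close> speaks of positive indices only, so the blocks must be
      known to be non-empty.\<close>
    have block: "card V \<ge> 1" if "\<sigma> \<in> NC N" "V \<in> \<sigma>" for \<sigma> V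
      using finite_block[OF NC_partition[OF that(1)] that(2)] partition_onD3[OF NC_partition[OF that(1)]] that(2)
      by (metis One_nat_def Suc_leI card_gt_0_iff)
    have "\<nu> (monom 1 N) = (\<Sum>\<sigma>\<in>NC N. \<Prod>V\<in>\<sigma>. free_cumulant \<nu> (card V))"
      using is_free_cumulants_free_cumulant[of \<nu>] \<open>N \<ge> 1\<close> by (simp add: is_free_cumulants_def)
    also have "\<dots> = (\<Sum>\<sigma>\<in>NC N. \<Prod>V\<in>\<sigma>. of_nat (card (connected_pairs {1..card V})))"
      by (intro sum.cong prod.cong refl cumulant block)
    also have "\<dots> = of_nat (\<Sum>\<sigma>\<in>NC N. \<Prod>V\<in>\<sigma>. card (connected_pairs {1..card V}))" by simp
    finally show ?thesis unfolding sum_NC_prod_connected_pairs .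
  qed
  show ?thesis
  proof (intro allI impI conjI)
    fix n :: nat assume n: "n \<ge> 1"
    \<comment> \<open>An odd moment counts pairs of pairings of an odd number of points.\<close>
    have "nc_pairings {1..2 * n - 1} = {}" using n by (intro nc_pairings_odd) auto
    then show "\<nu> (monom 1 (2 * n - 1)) = 0" using n by (subst moment) auto
    have "card {(\<pi>, \<rho>). \<pi> \<in> NC n \<and> \<rho> \<in> NC n \<and> strictly_noncrossing n \<pi> \<rho>} =
        card {(f, g). f \<in> nc_pairings {1..2 * n} \<and> g \<in> nc_pairings {1..2 * n} \<and>
          (\<exists>\<sigma>\<in>NC (2 * n). \<forall>V\<in>\<sigma>. connects f g V)}"
      by (rule card_fattening_pairs) (rule strictly_noncrossing_iff)
    then show "\<nu> (monom 1 (2 * n)) =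
        of_nat (card {(\<pi>, \<rho>). \<pi> \<in> NC n \<and> \<rho> \<in> NC n \<and> strictly_noncrossing n \<pi> \<rho>})"
      using n by (subst moment) auto
  qed
qed

end
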